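(* Let $e$ be an even positive integer, $q=2^e$, $d=(q^2+q+1)/3$, and $\sigma(X)=X+X^d+X^{dq}\in\mathbb{F}_{q^2}[X]$ (a permutation polynomial of $\mathbb{F}_{q^2}$). For $\alpha\in\mathbb{F}_q^*$ let $f_\alpha(x)=\operatorname{Tr}_{q^2}\bigl(\alpha(\sigma^{-1}(x))^3\bigr)$ for $x\in\mathbb{F}_{q^2}$. Then: (a) if $\alpha$ is a cube in $\mathbb{F}_q$, then $\{W_{f_\alpha}(\beta):\beta\in\mathbb{F}_q\}=\{2q,-2q\}$; (b) if $\alpha$ is not a cube in $\mathbb{F}_q$, then $\{W_{f_\alpha}(\beta):\beta\in\mathbb{F}_q\}=\{q\}$.
   Context: $\operatorname{Tr}_q$ and $\operatorname{Tr}_{q^2}$ denote the absolute traces from $\mathbb{F}_q$ and $\mathbb{F}_{q^2}$ to $\mathbb{F}_2$; $\sigma^{-1}$ is the compositional inverse of the permutation of $\mathbb{F}_{q^2}$ induced by $\sigma$. For a Boolean function $f$ on $\mathbb{F}_{q^2}$, its Walsh transform is $W_f(\beta)=\sum_{x\in\mathbb{F}_{q^2}}(-1)^{f(x)+\operatorname{Tr}_{q^2}(\beta x)}$ for $\beta\in\mathbb{F}_{q^2}$. *)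

theory Defs
  imports
    "HOL-Computational_Algebra.Polynomial"
    "HOL-Library.Z2"
    "HOL-Library.Cardinality"
begin

definition is_subfield :: "'a::field set \<Rightarrow> bool" where
  "is_subfield K \<longleftrightarrow> 0 \<in> K \<and> 1 \<in> K \<and>
     (\<forall>x\<in>K. \<forall>y\<in>K. x - y \<in> K \<and> x * y \<in> K) \<and> (\<forall>x\<in>K. inverse x \<in> K)"

(* abs_trace m is the absolute trace from a field with 2^m elements to F_2.  The trace sum lies
   in the prime subfield {0, 1}; it is transported to the type bit, the library's F_2.  The lemma
   of_bit_abs_trace below shows that nothing is lost by this. *)
definition abs_trace :: "nat \<Rightarrow> 'a::field \<Rightarrow> bit" where
  "abs_trace m x = (if (\<Sum>i<m. x ^ (2 ^ i)) = 0 then 0 else 1)"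

(* Walsh transform of a Boolean function on a field with 2^m elements.  The exponent is the F_2
   sum of two bits, read as 0 or 1. *)
definition walsh :: "nat \<Rightarrow> ('a::{field,finite} \<Rightarrow> bit) \<Rightarrow> 'a \<Rightarrow> int" where
  "walsh m f \<beta> = (\<Sum>x\<in>UNIV. (-1) ^ (of_bit (f x + abs_trace m (\<beta> * x)) :: nat))"

definition sigma :: "nat \<Rightarrow> 'a::field poly" where
  "sigma q = (let d = (q\<^sup>2 + q + 1) div 3 in monom 1 1 + monom 1 d + monom 1 (d * q))"

(* The function f_alpha on the field with q^2 = 2^(2e) elements, q = 2^e. *)
definition f_alpha :: "nat \<Rightarrow> 'a::field \<Rightarrow> 'a \<Rightarrow> bit" where
  "f_alpha e \<alpha> x = abs_trace (2 * e) (\<alpha> * (inv (poly (sigma (2 ^ e))) x) ^ 3)"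

lemma finite_field_power_card:
  fixes x :: "'a::{field,finite}"
  shows "x ^ CARD('a) = x"
proof (cases "x = 0")
  case True
  then show ?thesis by (simp add: zero_power)
next
  case False
  let ?U = "UNIV - {0::'a}"
  have "bij_betw (\<lambda>y. x * y) ?U ?U"
    by (rule bij_betw_byWitness[where f' = "\<lambda>y. y / x"]) (use False in auto)
  then have "(\<Prod>y\<in>?U. x * y) = (\<Prod>y\<in>?U. y)"
    by (rule prod.reindex_bij_betw)
  moreover have "(\<Prod>y\<in>?U. x * y) = x ^ card ?U * (\<Prod>y\<in>?U. y)"
    by (simp add: prod.distrib)
  moreover have "(\<Prod>y\<in>?U. y) \<noteq> (0::'a)"
    by simp
  ultimately have "x ^ card ?U = 1"
    by simp
  moreover have "CARD('a) = Suc (card ?U)"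
    by (metis UNIV_I card.remove finite)
  ultimately show ?thesis
    by (simp only: power_Suc mult_1_right)
qed

lemma of_bit_abs_trace:
  fixes x :: "'a::{field,finite}"
  assumes card: "CARD('a) = 2 ^ m"
  shows "of_bit (abs_trace m x) = (\<Sum>i<m. x ^ (2 ^ i))"
proof -
  have "(\<Sum>y\<in>UNIV. y + 1) = (\<Sum>y\<in>UNIV. y::'a)"
    by (rule sum.reindex_bij_betw) (rule bij_betw_byWitness[where f' = "\<lambda>y. y - 1"], auto)
  then have "(of_nat CARD('a) :: 'a) = 0"
    by (simp add: sum.distrib)
  then have two: "(2::'a) = 0"
    by (simp add: card)
  have sq: "(\<Sum>i<n. x ^ (2 ^ i))\<^sup>2 = (\<Sum>i<n. x ^ (2 ^ Suc i))" for n
  proof (induction n)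
    case (Suc n)
    have "(\<Sum>i<Suc n. x ^ (2 ^ i))\<^sup>2 = (\<Sum>i<n. x ^ (2 ^ i))\<^sup>2 + (x ^ (2 ^ n))\<^sup>2"
      by (simp only: sum.lessThan_Suc power2_sum two mult_zero_left add_0_right)
    also have "(x ^ (2 ^ n))\<^sup>2 = x ^ (2 ^ Suc n)"
      by (simp only: power_mult[symmetric] power_Suc2)
    finally show ?case
      by (simp only: Suc.IH sum.lessThan_Suc)
  qed simp
  let ?t = "\<Sum>i<m. x ^ (2 ^ i)"
  have "?t\<^sup>2 + x = (\<Sum>i<Suc m. x ^ (2 ^ i))"
    by (simp only: sq sum.lessThan_Suc_shift power_0 power_one_right add.commute)
  also have "\<dots> = ?t + x"
    using finite_field_power_card[of x] by (simp only: card sum.lessThan_Suc)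
  finally have "?t * (?t - 1) = 0"
    by (simp only: add_right_cancel power2_eq_square right_diff_distrib mult_1_right diff_self)
  then have "?t = 0 \<or> ?t = 1"
    by simp
  then show ?thesis
    unfolding abs_trace_def by (elim disjE) simp_all
qed

end

theory Submission
  imports Defs
begin

text \<open>
  Write \<open>T x = x + x ^ q\<close> for the relative trace to \<open>K\<close> and \<open>N x = x * x ^ q\<close> for the norm.
  Since \<open>\<sigma>(y) = y + T (y ^ d)\<close> and the absolute trace vanishes on \<open>K\<close>, the substitution
  \<open>x = \<sigma>(y)\<close> turns the Walsh transform at \<open>\<beta> \<in> K\<close> into the cubic sum
  \<open>S(\<beta>) = \<Sum>y. \<chi>(\<alpha> y^3 + \<beta> y)\<close>. Squaring it gives \<open>q^2\<close> times the sum of \<open>\<chi>(\<alpha> u^3 + \<beta> u)\<close> over the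
  radical \<open>\<alpha>^2 u^4 = \<alpha> u\<close>, which is \<open>{0}\<close> if \<open>\<alpha>\<close> is not a cube in \<open>K\<close>, and otherwise consists of
  four elements of \<open>K\<close>. Hence \<open>S(\<beta>) = \<plusminus>q\<close> or \<open>S(\<beta>) = \<plusminus>2q\<close>, respectively. The signs follow from
  the fact that the mean of \<open>S\<close> over \<open>K\<close> is \<open>q\<close>.

  For injectivity of \<open>\<sigma>\<close>: if \<open>z = y + t\<close> with \<open>t = T (y ^ d)\<close>, then
  \<open>(y ^ d) ^ 3 = y * N y\<close> and \<open>N (y ^ d) = N y\<close> give a relation for \<open>t\<close> which, once rewritten in
  terms of \<open>z\<close>, is linear in \<open>t\<close>.
\<close>

section \<open>Additive characters, trace polynomials and finite subfields\<close>

definition chi :: "nat \<Rightarrow> 'a::field \<Rightarrow> int" where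
  "chi m x = (-1) ^ (of_bit (abs_trace m x) :: nat)"

lemma minus_one_power_of_bit_add:
  "(-1) ^ (of_bit (a + b :: bit) :: nat) = ((-1) ^ (of_bit a :: nat) * (-1) ^ (of_bit b :: nat) :: int)"
  by (cases a; cases b) auto

text \<open>The trace sum is a polynomial of degree at most \<open>2 ^ (m - 1)\<close> with
  coefficient 1 there, which bounds its number of roots. The bound lies below \<open>2 ^ m\<close>,
  so any set of \<open>2 ^ m\<close> elements contains one with nonzero trace sum.\<close>

lemma card_trace_kernel_le:
  fixes A :: "'a::field set"
  assumes "m > 0"
  shows "card {x \<in> A. (\<Sum>i<m. x ^ (2 ^ i)) = 0} \<le> 2 ^ (m - 1)"
proof -
  define p :: "'a poly" where "p = (\<Sum>i<m. monom 1 (2 ^ i))"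
  have "coeff p (2 ^ (m - 1)) = (\<Sum>i<m. if i = m - 1 then 1 else 0)"
    unfolding p_def coeff_sum by (intro sum.cong) auto
  also have "\<dots> = 1"
    using assms by simp
  finally have p: "p \<noteq> 0"
    by auto
  have "degree p \<le> 2 ^ (m - 1)"
    unfolding p_def by (intro degree_sum_le) (auto simp: degree_monom_eq)
  moreover have "card {x. poly p x = 0} \<le> degree p"
    using p by (rule card_poly_roots_bound)
  moreover have "card {x \<in> A. (\<Sum>i<m. x ^ (2 ^ i)) = 0} \<le> card {x. poly p x = 0}"
    using p by (intro card_mono poly_roots_finite) (auto simp: p_def poly_sum poly_monom)
  ultimately show ?thesis
    by linarith
qed

lemma finite_subfield_power_card:
  fixes K :: "'a::field set"
  assumes "is_subfield K" "finite K" "x \<in> K"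
  shows "x ^ card K = x"
proof (cases "x = 0")
  case True
  moreover have "card K \<noteq> 0"
    using assms by auto
  ultimately show ?thesis
    by (simp add: zero_power)
next
  case False
  let ?U = "K - {0}"
  have "bij_betw (\<lambda>y. x * y) ?U ?U"
    by (rule bij_betw_byWitness[where f' = "\<lambda>y. inverse x * y"])
      (use False assms in \<open>auto simp: is_subfield_def mult.assoc[symmetric]\<close>)
  then have "(\<Prod>y\<in>?U. x * y) = (\<Prod>y\<in>?U. y)"
    by (rule prod.reindex_bij_betw)
  moreover have "(\<Prod>y\<in>?U. x * y) = x ^ card ?U * (\<Prod>y\<in>?U. y)"
    by (simp add: prod.distrib)
  moreover have "(\<Prod>y\<in>?U. y) \<noteq> 0"
    using assms by simp
  ultimately have "x ^ card ?U = 1"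
    by simp
  moreover have "card K = Suc (card ?U)"
    using assms by (intro card.remove) (auto simp: is_subfield_def)
  ultimately show ?thesis
    by (simp only: power_Suc mult_1_right)
qed

text \<open>The polynomial \<open>X ^ n - X\<close> with \<open>n = card K\<close> vanishes on
  \<open>K\<close> and has at most \<open>n\<close> roots. Membership in \<open>K\<close> thus
  becomes a Frobenius equation.\<close>

lemma finite_subfield_eq:
  fixes K :: "'a::field set"
  assumes "is_subfield K" "finite K"
  shows "K = {x. x ^ card K = x}"
proof (rule card_seteq)
  let ?n = "card K"
  define p :: "'a poly" where "p = monom 1 ?n - monom 1 1"
  have "card {0, 1 :: 'a} \<le> ?n"
    using assms by (intro card_mono) (auto simp: is_subfield_def)
  then have n: "?n > 1"
    by simp
  have "coeff p ?n = 1"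
    using n by (simp add: p_def)
  then have p: "p \<noteq> 0"
    by auto
  have eq: "{x. x ^ ?n = x} = {x. poly p x = 0}"
    by (simp add: p_def poly_monom)
  show "finite {x :: 'a. x ^ ?n = x}"
    unfolding eq using p by (rule poly_roots_finite)
  have "degree p \<le> ?n"
    unfolding p_def using n by (intro degree_diff_le) (auto simp: degree_monom_eq)
  then show "card {x :: 'a. x ^ ?n = x} \<le> ?n"
    unfolding eq using card_poly_roots_bound[OF p] by linarith
  show "K \<subseteq> {x. x ^ ?n = x}"
    using finite_subfield_power_card[OF assms] by auto
qed

lemma two_eq_0:
  assumes "CARD('a::{field,finite}) = 2 ^ m"
  shows "(2 :: 'a) = 0"
proof -
  have "(\<Sum>y\<in>UNIV. y + 1) = (\<Sum>y\<in>UNIV. y::'a)"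
    by (rule sum.reindex_bij_betw) (rule bij_betw_byWitness[where f' = "\<lambda>y. y - 1"], auto)
  then have "(of_nat CARD('a) :: 'a) = 0"
    by (simp add: sum.distrib)
  then show ?thesis
    by (simp add: assms)
qed

section \<open>Character sums in characteristic two\<close>

locale char_two_field =
  fixes m :: nat and F :: "'a::{field,finite} itself"
  assumes card_F: "CARD('a) = 2 ^ m"
begin

lemma two: "(2 :: 'a) = 0"
  using card_F by (rule two_eq_0)

lemma add_self [simp]: "x + x = (0 :: 'a)"
  by (metis mult_2 mult_zero_left two)

lemma minus_eq: "x - y = (x + y :: 'a)"
  by (metis add_self add_diff_cancel_right' add.assoc add_0_right)

lemma add_eq_0_iff_eq: "x + y = 0 \<longleftrightarrow> x = (y :: 'a)"
  by (metis minus_eq right_minus_eq)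

lemma m_pos: "m > 0"
proof (rule ccontr)
  assume "\<not> m > 0"
  then have "card (UNIV :: 'a set) = 1"
    using card_F by simp
  then obtain z :: 'a where "UNIV = {z}"
    by (rule card_1_singletonE)
  then show False
    by (metis UNIV_I singletonD zero_neq_one)
qed

lemma power_add_two: "(x + y :: 'a) ^ (2 ^ i) = x ^ (2 ^ i) + y ^ (2 ^ i)"
proof (induction i)
  case (Suc i)
  have "(x + y) ^ (2 ^ Suc i) = ((x + y) ^ (2 ^ i))\<^sup>2"
    by (simp only: power_Suc2 power_mult)
  also have "\<dots> = (x ^ (2 ^ i))\<^sup>2 + (y ^ (2 ^ i))\<^sup>2"
    by (simp only: Suc power2_sum two mult_zero_left add_0_right)
  finally show ?case
    by (simp only: power_Suc2 power_mult)
qed simp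

lemma of_bit_inj: "(of_bit a :: 'a) = of_bit b \<longleftrightarrow> a = b"
  by (cases a; cases b) auto

lemma of_bit_add: "(of_bit (a + b) :: 'a) = of_bit a + of_bit b"
  by (cases a; cases b) auto

lemma abs_trace_add: "abs_trace m (x + y :: 'a) = abs_trace m x + abs_trace m y"
  by (simp only: of_bit_inj[symmetric] of_bit_add of_bit_abs_trace[OF card_F] power_add_two sum.distrib)

text \<open>Squaring shifts the conjugates cyclically, because
  \<open>x ^ (2 ^ m) = x\<close>.\<close>

lemma abs_trace_square: "abs_trace m (x\<^sup>2 :: 'a) = abs_trace m x"
proof -
  have "(\<Sum>i<m. (x\<^sup>2) ^ (2 ^ i)) + x = (\<Sum>i<m. x ^ (2 ^ Suc i)) + x"
    by (simp add: power_mult[symmetric])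
  also have "\<dots> = (\<Sum>i<Suc m. x ^ (2 ^ i))"
    by (simp only: sum.lessThan_Suc_shift power_0 power_one_right add.commute)
  also have "\<dots> = (\<Sum>i<m. x ^ (2 ^ i)) + x"
    using finite_field_power_card[of x] by (simp only: card_F sum.lessThan_Suc)
  finally show ?thesis
    by (simp add: abs_trace_def)
qed

lemma chi_add: "chi m (x + y :: 'a) = chi m x * chi m y"
  by (simp add: chi_def abs_trace_add minus_one_power_of_bit_add)

lemma chi_square: "chi m (x\<^sup>2 :: 'a) = chi m x"
  by (simp add: chi_def abs_trace_square)

lemma chi_eq_1: "(\<Sum>i<m. (x::'a) ^ (2 ^ i)) = 0 \<Longrightarrow> chi m x = 1"
  by (simp add: chi_def abs_trace_def)

lemma chi_eq_minus_1: "(\<Sum>i<m. (x::'a) ^ (2 ^ i)) \<noteq> 0 \<Longrightarrow> chi m x = -1"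
  by (simp add: chi_def abs_trace_def)

text \<open>Translation by \<open>a\<close> is an involution of \<open>A\<close> and changes the
  sign of every summand, so the sum equals its own negative.\<close>

lemma sum_chi_eq_0:
  fixes t :: 'a
  assumes closed: "\<And>x y. x \<in> A \<Longrightarrow> y \<in> A \<Longrightarrow> x + y \<in> A"
    and a: "a \<in> A" "chi m (a * t) = -1"
  shows "(\<Sum>x\<in>A. chi m (x * t)) = 0"
proof -
  have "(\<Sum>x\<in>A. chi m ((x + a) * t)) = (\<Sum>x\<in>A. chi m (x * t))"
    by (rule sum.reindex_bij_betw, rule bij_betw_byWitness[where f' = "\<lambda>y. y + a"])
      (use closed a in \<open>auto simp: add.assoc\<close>)
  moreover have "(\<Sum>x\<in>A. chi m ((x + a) * t)) = - (\<Sum>x\<in>A. chi m (x * t))"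
    by (simp add: distrib_right chi_add a sum_negf)
  ultimately show ?thesis
    by simp
qed

lemma sum_chi_UNIV: "(\<Sum>x\<in>UNIV. chi m (x * t)) = (if t = 0 then 2 ^ m else 0)" for t :: 'a
proof (cases "t = 0")
  case True
  then show ?thesis
    by (simp add: chi_eq_1 card_F zero_power)
next
  case False
  have "card {x :: 'a \<in> UNIV. (\<Sum>i<m. x ^ (2 ^ i)) = 0} < 2 ^ m"
    using card_trace_kernel_le[OF m_pos, of "UNIV :: 'a set"]
    by (rule le_less_trans) (simp add: m_pos)
  then have "{x :: 'a \<in> UNIV. (\<Sum>i<m. x ^ (2 ^ i)) = 0} \<noteq> UNIV"
    using card_F by auto
  then obtain b :: 'a where "chi m b = -1"
    using chi_eq_minus_1 by auto
  then have "(\<Sum>x\<in>UNIV. chi m (x * t)) = 0"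
    using False by (intro sum_chi_eq_0[where a = "b / t"]) auto
  then show ?thesis
    using False by simp
qed

lemma bij_square: "bij (\<lambda>x :: 'a. x\<^sup>2)"
proof -
  have "inj (\<lambda>x :: 'a. x\<^sup>2)"
  proof (rule injI)
    fix x y :: 'a
    assume "x\<^sup>2 = y\<^sup>2"
    then have "(x + y)\<^sup>2 = 0"
      using power_add_two[of x y 1] by simp
    then show "x = y"
      by (simp add: add_eq_0_iff_eq)
  qed
  then show ?thesis
    by (simp add: bij_def finite_UNIV_inj_surj)
qed

text \<open>After the shift \<open>x = u + y\<close>, the product of two character values depends on
  \<open>y\<close> only through a character linear in \<open>y\<^sup>2\<close>. As squaring is a
  bijection, orthogonality removes every \<open>u\<close> at which the coefficient of
  \<open>y\<^sup>2\<close> is nonzero.\<close>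

lemma cubic_sum_square:
  fixes \<alpha> \<beta> :: 'a
  defines "\<phi> \<equiv> \<lambda>y. chi m (\<alpha> * y ^ 3 + \<beta> * y)"
  shows "(\<Sum>y\<in>UNIV. \<phi> y)\<^sup>2 = 2 ^ m * (\<Sum>u | \<alpha>\<^sup>2 * u ^ 4 + \<alpha> * u = 0. \<phi> u)"
proof -
  have shift: "\<phi> (u + y) * \<phi> y = \<phi> u * chi m (y\<^sup>2 * (\<alpha>\<^sup>2 * u ^ 4 + \<alpha> * u))" for u y
  proof -
    have "\<phi> (u + y) * \<phi> y = chi m (\<alpha> * (u + y) ^ 3 + \<beta> * (u + y) + (\<alpha> * y ^ 3 + \<beta> * y))"
      by (simp only: \<phi>_def chi_add)
    \<comment> \<open>The multiple of 2 collects everything that vanishes in characteristic two,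
      which leaves an identity valid in every commutative ring.\<close>
    also have "\<alpha> * (u + y) ^ 3 + \<beta> * (u + y) + (\<alpha> * y ^ 3 + \<beta> * y) =
        (\<alpha> * u ^ 3 + \<beta> * u) + \<alpha> * u\<^sup>2 * y + \<alpha> * u * y\<^sup>2 +
        2 * (\<alpha> * (u\<^sup>2 * y + u * y\<^sup>2 + y ^ 3) + \<beta> * y)"
      by algebra
    also have "\<dots> = (\<alpha> * u ^ 3 + \<beta> * u) + \<alpha> * u\<^sup>2 * y + \<alpha> * u * y\<^sup>2"
      by (simp only: two mult_zero_left add_0_right)
    \<comment> \<open>The term linear in \<open>y\<close> may be squared under the character; both
      mixed terms then become multiples of \<open>y\<^sup>2\<close>.\<close>
    also have "chi m \<dots> = \<phi> u * chi m ((\<alpha> * u\<^sup>2 * y)\<^sup>2) * chi m (\<alpha> * u * y\<^sup>2)"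
      by (simp only: chi_add \<phi>_def chi_square)
    also have "\<dots> = \<phi> u * chi m ((\<alpha> * u\<^sup>2 * y)\<^sup>2 + \<alpha> * u * y\<^sup>2)"
      by (simp add: chi_add)
    also have "(\<alpha> * u\<^sup>2 * y)\<^sup>2 + \<alpha> * u * y\<^sup>2 = y\<^sup>2 * (\<alpha>\<^sup>2 * u ^ 4 + \<alpha> * u)"
      by algebra
    finally show ?thesis .
  qed
  have "(\<Sum>y\<in>UNIV. \<phi> y)\<^sup>2 = (\<Sum>y\<in>UNIV. \<Sum>x\<in>UNIV. \<phi> x * \<phi> y)"
    by (simp add: power2_eq_square sum_product mult.commute)
  also have "\<dots> = (\<Sum>y\<in>UNIV. \<Sum>u\<in>UNIV. \<phi> (u + y) * \<phi> y)"
    by (intro sum.cong refl sum.reindex_bij_betw[symmetric]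
        bij_betw_byWitness[where f' = "\<lambda>x. x - y" for y]) auto
  also have "\<dots> = (\<Sum>u\<in>UNIV. \<phi> u * (\<Sum>y\<in>UNIV. chi m (y\<^sup>2 * (\<alpha>\<^sup>2 * u ^ 4 + \<alpha> * u))))"
    unfolding shift by (subst sum.swap) (simp add: sum_distrib_left)
  also have "\<dots> = (\<Sum>u\<in>UNIV. \<phi> u * (\<Sum>y\<in>UNIV. chi m (y * (\<alpha>\<^sup>2 * u ^ 4 + \<alpha> * u))))"
    using sum.reindex_bij_betw[OF bij_square, of "\<lambda>y. chi m (y * c)" for c] by simp
  also have "\<dots> = (\<Sum>u\<in>UNIV. if \<alpha>\<^sup>2 * u ^ 4 + \<alpha> * u = 0 then 2 ^ m * \<phi> u else 0)"
    unfolding sum_chi_UNIV by (intro sum.cong) auto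
  also have "\<dots> = 2 ^ m * (\<Sum>u | \<alpha>\<^sup>2 * u ^ 4 + \<alpha> * u = 0. \<phi> u)"
    by (simp add: sum.If_cases sum_distrib_left)
  finally show ?thesis .
qed

end

section \<open>Relative trace and norm of the quadratic extension over \<open>K\<close>\<close>

locale quadratic_extension = char_two_field "2 * e" F
  for e :: nat and F :: "'a::{field,finite} itself" +
  fixes q :: nat and K :: "'a set"
  assumes e_pos: "e > 0" and e_even: "even e" and q_def: "q = 2 ^ e"
    and K: "is_subfield K" "card K = q"
begin

lemma mem_K_iff: "x \<in> K \<longleftrightarrow> x ^ q = x"
  using finite_subfield_eq[OF K(1)] K(2) by auto

lemma card_q: "CARD('a) = q\<^sup>2"
  using card_F by (simp add: q_def power_mult[symmetric] mult.commute)

lemma power_q_q: "((x::'a) ^ q) ^ q = x"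
  using finite_field_power_card[of x] by (simp add: card_q power_mult power2_eq_square)

lemma power_q_add: "(x + y :: 'a) ^ q = x ^ q + y ^ q"
  by (simp add: q_def power_add_two)

lemma q_pos: "q > 0"
  by (simp add: q_def)

lemma K_add: "x \<in> K \<Longrightarrow> y \<in> K \<Longrightarrow> x + y \<in> K"
  by (simp add: mem_K_iff power_q_add)

lemma K_mult: "x \<in> K \<Longrightarrow> y \<in> K \<Longrightarrow> x * y \<in> K"
  by (simp add: mem_K_iff power_mult_distrib)

lemma K_power: "x \<in> K \<Longrightarrow> x ^ n \<in> K"
  by (metis mem_K_iff power_mult mult.commute)

lemma K_divide: "x \<in> K \<Longrightarrow> y \<in> K \<Longrightarrow> x / y \<in> K"
  by (simp add: mem_K_iff power_divide)

lemma trace_mem_K: "x + x ^ q \<in> K"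
  by (simp add: mem_K_iff power_q_add power_q_q add.commute)

lemma norm_mem_K: "x * x ^ q \<in> K"
  by (simp add: mem_K_iff power_mult_distrib power_q_q mult.commute)

text \<open>Transitivity of the trace: the summands with index at least \<open>e\<close> are the
  lower ones evaluated at the conjugate \<open>x ^ q\<close>.\<close>

lemma trace_tower: "(\<Sum>i<2 * e. x ^ (2 ^ i)) = (\<Sum>i<e. (x + x ^ q :: 'a) ^ (2 ^ i))"
proof -
  have "(\<Sum>i<e + n. x ^ (2 ^ i)) = (\<Sum>i<e. x ^ (2 ^ i)) + (\<Sum>i<n. (x ^ q) ^ (2 ^ i))" for n
    by (induction n) (simp_all add: q_def power_mult[symmetric] power_add add.assoc)
  from this[of e] show ?thesis
    by (simp add: power_add_two sum.distrib mult_2)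
qed

lemma chi_K: "x \<in> K \<Longrightarrow> chi (2 * e) x = 1"
  by (rule chi_eq_1) (simp add: trace_tower mem_K_iff zero_power)

text \<open>Under the trace form \<open>K\<close> is its own annihilator: the relative trace is zero
  on \<open>K\<close> and nonzero outside it.\<close>

lemma sum_chi_K: "(\<Sum>\<beta>\<in>K. chi (2 * e) (\<beta> * y)) = (if y \<in> K then int q else 0)"
proof (cases "y \<in> K")
  case True
  then show ?thesis
    using K(2) by (simp add: chi_K K_mult)
next
  case False
  define t where "t = y + y ^ q"
  have t: "t \<in> K" "t \<noteq> 0"
    using False trace_mem_K[of y] by (auto simp: t_def mem_K_iff add_eq_0_iff_eq)
  have "card {x \<in> K. (\<Sum>i<e. x ^ (2 ^ i)) = 0} < q"
    unfolding q_def using card_trace_kernel_le[OF e_pos, of K]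
    by (rule le_less_trans) (simp add: e_pos)
  then have "{x \<in> K. (\<Sum>i<e. x ^ (2 ^ i)) = 0} \<noteq> K"
    using K(2) by auto
  then obtain b where b: "b \<in> K" "(\<Sum>i<e. b ^ (2 ^ i)) \<noteq> 0"
    by auto
  \<comment> \<open>By linearity over \<open>K\<close>, the relative trace of
    \<open>b / t * y\<close> is \<open>b\<close>, whose trace down to the prime field is
    nonzero.\<close>
  have bt: "b / t \<in> K"
    using b t by (simp add: K_divide)
  have "b / t * y + (b / t * y) ^ q = b / t * t"
    using bt by (simp only: mem_K_iff t_def power_mult_distrib distrib_left)
  then have "chi (2 * e) (b / t * y) = -1"
    using b t by (intro chi_eq_minus_1) (simp add: trace_tower)
  then show ?thesis
    using False sum_chi_eq_0[OF K_add bt] by simp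
qed

text \<open>Summing over \<open>\<beta>\<close> first keeps only the \<open>y\<close> in
  \<open>K\<close>, and there the cubic term also lies in \<open>K\<close> and has character value
  1.\<close>

lemma sum_cubic_sum:
  assumes "\<alpha> \<in> K"
  shows "(\<Sum>\<beta>\<in>K. \<Sum>y\<in>UNIV. chi (2 * e) (\<alpha> * y ^ 3 + \<beta> * y)) = (int q)\<^sup>2"
proof -
  have "(\<Sum>\<beta>\<in>K. \<Sum>y\<in>UNIV. chi (2 * e) (\<alpha> * y ^ 3 + \<beta> * y)) =
      (\<Sum>y\<in>UNIV. chi (2 * e) (\<alpha> * y ^ 3) * (\<Sum>\<beta>\<in>K. chi (2 * e) (\<beta> * y)))"
    by (subst sum.swap) (simp add: chi_add sum_distrib_left)
  also have "\<dots> = (\<Sum>y\<in>UNIV. if y \<in> K then int q else 0)"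
    unfolding sum_chi_K using assms by (intro sum.cong) (auto simp: chi_K K_mult K_power)
  also have "\<dots> = (int q)\<^sup>2"
    using K(2) by (simp add: sum.If_cases power2_eq_square)
  finally show ?thesis .
qed

section \<open>Cubes and cube roots of unity\<close>

lemma q_mod_3: "q mod 3 = 1"
proof -
  obtain k where "e = 2 * k"
    using e_even by blast
  then have "q mod 3 = (4 mod 3) ^ k mod 3"
    unfolding power_mod by (simp add: q_def power_mult)
  then show ?thesis
    by simp
qed

lemma q_eq: "q = 3 * (q div 3) + 1"
  using q_mod_3 by presburger

lemma K_power_third:
  assumes "x \<in> K" "x \<noteq> 0"
  shows "(x ^ (q div 3)) ^ 3 = 1"
proof -
  have "x ^ (3 * (q div 3) + 1) = x"
    using assms(1) q_eq by (simp add: mem_K_iff)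
  then show ?thesis
    using assms(2) by (simp add: power_mult[symmetric] mult.commute)
qed

lemma cube_roots_of_unity_mem_K:
  assumes "(x::'a) ^ 3 = 1"
  shows "x \<in> K"
proof -
  have "x ^ (3 * (q div 3) + 1) = x"
    using assms by (simp add: power_mult)
  then show ?thesis
    unfolding mem_K_iff q_eq[symmetric] .
qed

text \<open>With \<open>q = 3 * k + 1\<close>, the polynomial \<open>X ^ k - 1\<close> has too few
  roots to vanish on all \<open>3 * k\<close> nonzero elements of \<open>K\<close>. A non-root
  \<open>y\<close> gives the primitive cube root of unity \<open>y ^ k\<close>.\<close>

lemma card_cube_roots_of_unity: "card {x :: 'a. x ^ 3 = 1} = 3"
proof -
  define k where "k = q div 3"
  define p :: "'a poly" where "p = monom 1 k - 1"
  have "q > 1"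
    unfolding q_def using e_pos by (intro one_less_power) auto
  then have k: "k > 0" "q = 3 * k + 1"
    using q_eq by (auto simp: k_def)
  have "coeff p k = 1"
    using k by (simp add: p_def)
  then have p: "p \<noteq> 0"
    by auto
  have "degree p \<le> k"
    unfolding p_def by (intro degree_diff_le) (auto simp: degree_monom_eq)
  then have "card {x. poly p x = 0} \<le> k"
    using card_poly_roots_bound[OF p] by linarith
  moreover have "card (K - {0}) = 3 * k"
    using K k mem_K_iff[of 0] by (simp add: card_Diff_singleton)
  ultimately have "\<not> K - {0} \<subseteq> {x. poly p x = 0}"
    using k(1) card_mono[OF poly_roots_finite[OF p], of "K - {0}"] by linarith
  then obtain y where y: "y \<in> K" "y \<noteq> 0" "y ^ k \<noteq> 1"
    by (auto simp: p_def poly_monom)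
  define w where "w = y ^ k"
  have w: "w ^ 3 = 1" "w \<noteq> 1"
    using y K_power_third by (auto simp: w_def k_def)
  have "(w - 1) * (w\<^sup>2 + w + 1) = 0"
    using w(1) by algebra
  then have w2: "w\<^sup>2 + w + 1 = 0"
    using w(2) by simp
  have "x ^ 3 = 1 \<longleftrightarrow> x \<in> {1, w, w\<^sup>2}" for x
  proof -
    have "x ^ 3 - 1 = (x - 1) * ((x - w) * (x - w\<^sup>2))"
      using w(1) w2 by algebra
    then show ?thesis
      by (metis insert_iff mult_eq_0_iff right_minus_eq singletonD)
  qed
  then have "{x. x ^ 3 = 1} = {1, w, w\<^sup>2}"
    by blast
  moreover have "w\<^sup>2 \<noteq> 1" "w\<^sup>2 \<noteq> w"
    using w by (auto simp: power3_eq_cube power2_eq_square)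
  ultimately show ?thesis
    using w(2) by (auto simp: card_insert_if)
qed

text \<open>The norm of \<open>w\<close> lies in \<open>K\<close> and has cube
  \<open>\<alpha>\<^sup>2\<close>, so for nonzero \<open>\<alpha>\<close> the quotient of
  \<open>\<alpha>\<close> by this norm is a cube root of \<open>\<alpha>\<close> in
  \<open>K\<close>.\<close>

lemma cube_mem_K_imp:
  assumes "w ^ 3 = \<alpha>" "\<alpha> \<in> K"
  shows "\<exists>b\<in>K. \<alpha> = b ^ 3"
proof (cases "\<alpha> = 0")
  case True
  then show ?thesis
    using assms by (intro bexI[of _ \<alpha>]) auto
next
  case False
  have "(w * w ^ q) ^ 3 = w ^ 3 * (w ^ 3) ^ q"
    by (simp add: power_mult_distrib power_mult[symmetric] mult.commute)
  also have "\<dots> = \<alpha>\<^sup>2"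
    using assms by (simp add: mem_K_iff power2_eq_square)
  finally have "\<alpha> = (\<alpha> / (w * w ^ q)) ^ 3"
    using False by (simp add: power_divide power2_eq_square power3_eq_cube)
  then show ?thesis
    using K_divide[OF assms(2) norm_mem_K] by blast
qed

section \<open>The permutation induced by \<open>sigma\<close>\<close>

lemma poly_sigma:
  assumes "d = (q\<^sup>2 + q + 1) div 3"
  shows "poly (sigma q) (x::'a) = x + (x ^ d + (x ^ d) ^ q)"
  unfolding sigma_def Let_def assms[symmetric] by (simp add: poly_monom power_mult add.assoc)

text \<open>The first identity combines \<open>3 * d = q\<^sup>2 + q + 1\<close> with
  \<open>x ^ (q\<^sup>2) = x\<close>. For the second, \<open>q = 3 * k + 1\<close> gives
  \<open>d = 3 * k * (k + 1) + 1\<close>, which is 1 modulo \<open>q - 1\<close>.\<close>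

lemma d_identities:
  assumes "d = (q\<^sup>2 + q + 1) div 3"
  shows "((x::'a) ^ d) ^ 3 = x * (x * x ^ q)" "x \<in> K \<Longrightarrow> x ^ d = x"
proof -
  obtain k where k: "q = 3 * k + 1"
    using q_mod_3 by (metis div_mult_mod_eq mult.commute)
  then have "q\<^sup>2 + q + 1 = 3 * (3 * k\<^sup>2 + 3 * k + 1)"
    by (simp add: power2_eq_square algebra_simps)
  then have d: "d = 3 * k\<^sup>2 + 3 * k + 1" "d * 3 = q\<^sup>2 + q + 1"
    unfolding assms by simp_all
  have "(x ^ d) ^ 3 = x ^ (q\<^sup>2 + q + 1)"
    by (simp only: power_mult[symmetric] d(2))
  also have "\<dots> = (x ^ q) ^ q * x ^ q * x"
    by (simp add: power_add power2_eq_square power_mult)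
  finally show "(x ^ d) ^ 3 = x * (x * x ^ q)"
    by (simp add: power_q_q mult_ac)
  assume x: "x \<in> K"
  show "x ^ d = x"
  proof (cases "x = 0")
    case True
    then show ?thesis
      using d(1) by simp
  next
    case False
    have "q div 3 = k"
      using k by simp
    then have "x ^ (3 * k) = 1"
      using K_power_third[OF x False] by (simp add: power_mult[symmetric] mult.commute)
    moreover have "x ^ d = (x ^ (3 * k)) ^ k * x ^ (3 * k) * x"
      by (simp add: d(1) power_add power_mult[symmetric] power2_eq_square mult.assoc)
    ultimately show ?thesis
      by simp
  qed
qed

text \<open>Expanding the cube of \<open>w + w'\<close> gives a cubic equation for \<open>t\<close>
  over \<open>y\<close> and \<open>y'\<close>. Rewritten in \<open>z = y + t\<close> and
  \<open>z' = y' + t\<close>, its terms in \<open>t ^ 3\<close> and \<open>t\<^sup>2\<close> cancel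
  in characteristic two.\<close>

lemma linear_relation:
  fixes t w w' y y' :: 'a
  assumes t: "t = w + w'"
    and w: "w ^ 3 = y * (y * y')" "w' ^ 3 = y' * (y * y')" "w * w' = y * y'"
  shows "t * ((y + t) * (y' + t) + (y + t + (y' + t))\<^sup>2) =
    (y + t) * (y' + t) * (y + t + (y' + t))"
proof -
  have "t ^ 3 = w ^ 3 + w' ^ 3 + (w * w') * t + 2 * (w * w' * t)"
    unfolding t by algebra
  then have t3: "t ^ 3 = y * (y * y') + y' * (y * y') + (y * y') * t"
    by (simp only: w two mult_zero_left add_0_right)
  have s: "y + t + (y' + t) = y + y'"
    by (metis add.assoc add.commute add_self add_0_right)
  have "t * ((y + t) * (y' + t) + (y + y')\<^sup>2) = (y + t) * (y' + t) * (y + y') + 2 * (y * y' * t)"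
    using t3 by algebra
  then show ?thesis
    by (simp only: s two mult_zero_left add_0_right)
qed

text \<open>The map fixes \<open>K\<close> pointwise and, since \<open>t y\<close> lies in
  \<open>K\<close>, preserves the complement of \<open>K\<close>. For a value \<open>z\<close>
  outside \<open>K\<close>, the linear relation determines \<open>t y\<close> and hence
  \<open>y = z + t y\<close>.\<close>

lemma bij_sigma: "bij (poly (sigma q :: 'a poly))"
proof -
  define d where "d = (q\<^sup>2 + q + 1) div 3"
  define t where "t = (\<lambda>y :: 'a. y ^ d + (y ^ d) ^ q)"
  have sigma: "poly (sigma q) y = y + t y" for y :: 'a
    unfolding t_def by (rule poly_sigma[OF d_def])
  have t_K: "t y \<in> K" for y
    unfolding t_def by (rule trace_mem_K)
  have sigma_K: "y + t y = y" if "y \<in> K" for y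
    using that by (simp add: t_def d_identities(2)[OF d_def] mem_K_iff)
  have linear: "t y * (z * z ^ q + (z + z ^ q)\<^sup>2) = (z * z ^ q) * (z + z ^ q)"
    if z: "z = y + t y" for y z
  proof -
    define w where "w = y ^ d"
    have w3: "w ^ 3 = y * (y * y ^ q)"
      unfolding w_def by (rule d_identities(1)[OF d_def])
    \<comment> \<open>The norm of \<open>y\<close> lies in \<open>K\<close>, where the
      \<open>d\<close>-th power is the identity.\<close>
    have ww: "w * w ^ q = y * y ^ q"
      using d_identities(2)[OF d_def norm_mem_K, of y]
      by (simp add: w_def power_mult_distrib power_mult[symmetric] mult.commute)
    have wq3: "(w ^ q) ^ 3 = y ^ q * (y * y ^ q)"
    proof -
      have "(w ^ q) ^ 3 = (w ^ 3) ^ q"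
        by (simp add: power_mult[symmetric] mult.commute)
      then show ?thesis
        by (simp add: w3 power_mult_distrib power_q_q mult_ac)
    qed
    have zq: "z ^ q = y ^ q + t y"
      using t_K[of y] by (simp add: z power_q_add mem_K_iff)
    have tw: "t y = w + w ^ q"
      by (simp add: t_def w_def)
    show ?thesis
      unfolding zq unfolding z using tw w3 wq3 ww by (rule linear_relation)
  qed
  have "inj (poly (sigma q :: 'a poly))"
  proof (rule injI)
    fix x y :: 'a
    assume eq: "poly (sigma q) x = poly (sigma q) y"
    define z where "z = poly (sigma q) x"
    have zx: "z = x + t x" and zy: "z = y + t y"
      using eq by (simp_all add: z_def sigma)
    show "x = y"
    proof (cases "z \<in> K")
      case True
      have "x = z + t x" "y = z + t y"
        by (simp add: zx add.assoc, simp add: zy add.assoc)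
      then have "x \<in> K" "y \<in> K"
        using True K_add t_K by metis+
      then show ?thesis
        using zx zy sigma_K by simp
    next
      case False
      then have s: "z + z ^ q \<noteq> 0"
        by (auto simp: mem_K_iff add_eq_0_iff_eq)
      \<comment> \<open>If the coefficient of \<open>t\<close> were zero, the relation would force
        the norm of \<open>z\<close> to vanish, and then its relative trace as well.\<close>
      have "z * z ^ q + (z + z ^ q)\<^sup>2 \<noteq> 0"
      proof
        assume 0: "z * z ^ q + (z + z ^ q)\<^sup>2 = 0"
        then have "z * z ^ q = 0"
          using linear[OF zx] s by simp
        with 0 have "(z + z ^ q)\<^sup>2 = 0"
          by (simp only: add_0_left)
        then show False
          using s by simp
      qed
      then have "t x = t y"
        using linear[OF zx] linear[OF zy] by (metis mult_right_cancel)
      then show ?thesis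
        using zx zy by (metis add_right_cancel)
    qed
  qed
  then show ?thesis
    by (simp add: bij_def finite_UNIV_inj_surj)
qed

section \<open>Walsh values as cubic sums, and their absolute values\<close>

lemma walsh_f_alpha:
  assumes "\<beta> \<in> K"
  shows "walsh (2 * e) (f_alpha e \<alpha>) \<beta> = (\<Sum>y\<in>UNIV. chi (2 * e) (\<alpha> * y ^ 3 + \<beta> * y))"
proof -
  let ?\<sigma> = "poly (sigma q :: 'a poly)"
  define d where "d = (q\<^sup>2 + q + 1) div 3"
  have inv: "inv ?\<sigma> (?\<sigma> y) = y" for y
    using bij_sigma by (simp add: bij_is_inj)
  have "walsh (2 * e) (f_alpha e \<alpha>) \<beta> =
      (\<Sum>x\<in>UNIV. chi (2 * e) (\<alpha> * (inv ?\<sigma> x) ^ 3) * chi (2 * e) (\<beta> * x))"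
    by (simp only: walsh_def f_alpha_def minus_one_power_of_bit_add chi_def q_def)
  also have "\<dots> = (\<Sum>y\<in>UNIV. chi (2 * e) (\<alpha> * (inv ?\<sigma> (?\<sigma> y)) ^ 3) * chi (2 * e) (\<beta> * ?\<sigma> y))"
    by (rule sum.reindex_bij_betw[OF bij_sigma, symmetric])
  also have "\<dots> = (\<Sum>y\<in>UNIV. chi (2 * e) (\<alpha> * y ^ 3 + \<beta> * y))"
  proof (rule sum.cong[OF refl])
    fix y :: 'a
    \<comment> \<open>The part of \<open>sigma\<close> beyond \<open>y\<close> is a relative trace,
      so it is invisible to the character at \<open>\<beta>\<close> in \<open>K\<close>.\<close>
    have "chi (2 * e) (\<beta> * (y ^ d + (y ^ d) ^ q)) = 1"
      using assms by (intro chi_K K_mult trace_mem_K)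
    then show "chi (2 * e) (\<alpha> * (inv ?\<sigma> (?\<sigma> y)) ^ 3) * chi (2 * e) (\<beta> * ?\<sigma> y) =
        chi (2 * e) (\<alpha> * y ^ 3 + \<beta> * y)"
      unfolding inv by (simp add: poly_sigma[OF d_def] distrib_left[of \<beta> y] chi_add)
  qed
  finally show ?thesis .
qed

lemma cubic_sum_kernel:
  assumes "\<alpha> \<noteq> (0::'a)"
  shows "{u. \<alpha>\<^sup>2 * u ^ 4 + \<alpha> * u = 0} = insert 0 {u. \<alpha> * u ^ 3 = 1}"
proof -
  have "\<alpha>\<^sup>2 * u ^ 4 + \<alpha> * u = 0 \<longleftrightarrow> u = 0 \<or> \<alpha> * u ^ 3 = 1" for u
  proof -
    have "\<alpha>\<^sup>2 * u ^ 4 + \<alpha> * u = \<alpha> * u * (\<alpha> * u ^ 3 + 1)"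
      by algebra
    then show ?thesis
      using assms by (simp add: add_eq_0_iff_eq)
  qed
  then show ?thesis
    by auto
qed

text \<open>The nonzero radical elements are the three cube roots of unity divided by
  \<open>c\<close>. They lie in \<open>K\<close> together with 0, so each of the four contributes 1
  and the square is \<open>4 * q\<^sup>2\<close>.\<close>

lemma cubic_sum_cube:
  fixes c \<beta> :: 'a
  assumes "c \<in> K" "c \<noteq> 0" "\<beta> \<in> K"
  defines "S \<equiv> \<Sum>y\<in>UNIV. chi (2 * e) (c ^ 3 * y ^ 3 + \<beta> * y)"
  shows "S = 2 * int q \<or> S = - (2 * int q)"
proof -
  let ?R = "{u. c ^ 3 * u ^ 3 = 1}"
  have "bij_betw (\<lambda>u. c * u) ?R {x. x ^ 3 = 1}"
    by (rule bij_betw_byWitness[where f' = "\<lambda>x. x / c"])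
      (use assms in \<open>auto simp: power_mult_distrib power_divide\<close>)
  then have card: "card ?R = 3"
    using card_cube_roots_of_unity by (simp add: bij_betw_same_card)
  have R: "u \<in> K" if "u \<in> ?R" for u
  proof -
    have "c * u \<in> K"
      using that by (intro cube_roots_of_unity_mem_K) (simp add: power_mult_distrib)
    then show ?thesis
      using K_divide[of "c * u" c] assms by simp
  qed
  have "S\<^sup>2 = 2 ^ (2 * e) * (\<Sum>u\<in>insert 0 ?R. chi (2 * e) (c ^ 3 * u ^ 3 + \<beta> * u))"
    unfolding S_def cubic_sum_square
    by (subst cubic_sum_kernel) (simp add: assms, rule refl)
  also have "(\<Sum>u\<in>insert 0 ?R. chi (2 * e) (c ^ 3 * u ^ 3 + \<beta> * u)) = (\<Sum>u\<in>insert 0 ?R. 1)"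
    using assms R by (intro sum.cong refl chi_K K_add K_mult K_power)
      (auto simp: mem_K_iff q_pos)
  also have "\<dots> = 4"
    by (simp add: card)
  finally have "S\<^sup>2 = (2 * int q)\<^sup>2"
    by (simp add: q_def power_mult_distrib power_mult[symmetric] mult.commute)
  then show ?thesis
    by (simp only: power2_eq_iff)
qed

text \<open>A nonzero radical element \<open>u\<close> would make \<open>1 / u\<close> a cube root
  of \<open>\<alpha>\<close> in the large field, and the norm argument would then give one in
  \<open>K\<close>. Only 0 contributes to the square.\<close>

lemma cubic_sum_non_cube:
  fixes \<alpha> \<beta> :: 'a
  assumes "\<alpha> \<in> K" "\<alpha> \<noteq> 0" "\<not> (\<exists>b\<in>K. \<alpha> = b ^ 3)"
  defines "S \<equiv> \<Sum>y\<in>UNIV. chi (2 * e) (\<alpha> * y ^ 3 + \<beta> * y)"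
  shows "S = int q \<or> S = - int q"
proof -
  have "\<alpha> * u ^ 3 \<noteq> 1" for u
  proof
    assume "\<alpha> * u ^ 3 = 1"
    then have "(1 / u) ^ 3 = \<alpha>"
      by (metis divide_eq_eq mult_zero_right zero_neq_one power_one power_divide)
    then show False
      using cube_mem_K_imp assms by blast
  qed
  then have "{u. \<alpha>\<^sup>2 * u ^ 4 + \<alpha> * u = 0} = {0}"
    using assms by (simp add: cubic_sum_kernel)
  then have "S\<^sup>2 = 2 ^ (2 * e) * (\<Sum>u\<in>{0}. chi (2 * e) (\<alpha> * u ^ 3 + \<beta> * u))"
    unfolding S_def cubic_sum_square by simp
  then have "S\<^sup>2 = (int q)\<^sup>2"
    using chi_K[of 0] by (simp add: mem_K_iff q_pos q_def power_mult[symmetric] mult.commute)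
  then show ?thesis
    by (simp only: power2_eq_iff)
qed

end

section \<open>Determination of the signs from the mean over \<open>K\<close>\<close>

theorem theorem1p2:
  fixes e q :: nat and K :: "'a::{field,finite} set"
  assumes "e > 0" and "even e" and "q = 2 ^ e"
    and "CARD('a) = q\<^sup>2"
    and "is_subfield K" and "card K = q"
  shows "bij (poly (sigma q :: 'a poly)) \<and>
    (\<forall>\<alpha>\<in>K - {0}.
      ((\<exists>b\<in>K. \<alpha> = b ^ 3) \<longrightarrow>
        {walsh (2 * e) (f_alpha e \<alpha>) \<beta> | \<beta>. \<beta> \<in> K} = {2 * int q, - 2 * int q}) \<and>
      (\<not> (\<exists>b\<in>K. \<alpha> = b ^ 3) \<longrightarrow>
        {walsh (2 * e) (f_alpha e \<alpha>) \<beta> | \<beta>. \<beta> \<in> K} = {int q}))"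
proof -
  interpret quadratic_extension e "TYPE('a)" q K
    by unfold_locales (use assms in \<open>auto simp: power_mult[symmetric] mult.commute\<close>)
  define S where "S = (\<lambda>\<alpha> \<beta> :: 'a. \<Sum>y\<in>UNIV. chi (2 * e) (\<alpha> * y ^ 3 + \<beta> * y))"
  have walsh_image: "{walsh (2 * e) (f_alpha e \<alpha>) \<beta> | \<beta>. \<beta> \<in> K} = S \<alpha> ` K" for \<alpha>
    unfolding Setcompr_eq_image by (rule image_cong) (simp_all add: walsh_f_alpha S_def)
  have mean: "(\<Sum>\<beta>\<in>K. S \<alpha> \<beta>) = int q * int q" if "\<alpha> \<in> K" for \<alpha>
    using sum_cubic_sum[OF that] by (simp add: S_def power2_eq_square)
  \<comment> \<open>A constant value must equal the mean \<open>q\<close>. In the cube case neither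
    \<open>2 * q\<close> nor \<open>- 2 * q\<close> does, so neither sign can occur alone.\<close>
  have const: "c = int q" if "\<alpha> \<in> K" "\<And>\<beta>. \<beta> \<in> K \<Longrightarrow> S \<alpha> \<beta> = c" for \<alpha> c
  proof -
    have "int q * c = int q * int q"
      using mean[OF that(1)] that(2) assms(6) by simp
    then show ?thesis
      using q_pos by simp
  qed
  have cube: "S \<alpha> ` K = {2 * int q, - 2 * int q}"
    if \<alpha>: "\<alpha> \<in> K" "\<alpha> \<noteq> 0" and "b \<in> K" "\<alpha> = b ^ 3" for \<alpha> b
  proof -
    have pm: "S \<alpha> \<beta> \<in> {2 * int q, - 2 * int q}" if "\<beta> \<in> K" for \<beta>
      using cubic_sum_cube[of b \<beta>] that \<open>b \<in> K\<close> \<open>\<alpha> = b ^ 3\<close> \<alpha> by (auto simp: S_def)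
    have "\<exists>\<beta>\<in>K. S \<alpha> \<beta> = 2 * int q"
      using pm const[OF \<alpha>(1), of "- 2 * int q"] q_pos by force
    moreover have "\<exists>\<beta>\<in>K. S \<alpha> \<beta> = - 2 * int q"
      using pm const[OF \<alpha>(1), of "2 * int q"] q_pos by force
    ultimately have "{2 * int q, - 2 * int q} \<subseteq> S \<alpha> ` K"
      by (metis empty_subsetI imageI insert_subset)
    then show ?thesis
      using pm by blast
  qed
  have non_cube: "S \<alpha> ` K = {int q}"
    if \<alpha>: "\<alpha> \<in> K" "\<alpha> \<noteq> 0" and "\<not> (\<exists>b\<in>K. \<alpha> = b ^ 3)" for \<alpha>
  proof -
    have pm: "S \<alpha> \<beta> = int q \<or> S \<alpha> \<beta> = - int q" for \<beta>
      using cubic_sum_non_cube[OF that] by (simp add: S_def)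
    \<comment> \<open>Here the mean \<open>q\<close> is also the largest possible value, so the
      nonnegative deficits sum to zero and each one vanishes.\<close>
    have "(\<Sum>\<beta>\<in>K. int q - S \<alpha> \<beta>) = 0"
      using mean[OF \<alpha>(1)] assms(6) by (simp add: sum_subtractf)
    moreover have "0 \<le> int q - S \<alpha> \<beta>" for \<beta>
      using pm[of \<beta>] by auto
    ultimately have "S \<alpha> \<beta> = int q" if "\<beta> \<in> K" for \<beta>
      using that by (simp add: sum_nonneg_eq_0_iff)
    moreover have "K \<noteq> {}"
      using \<alpha> by auto
    ultimately show ?thesis
      by auto
  qed
  show ?thesis
    unfolding walsh_image using bij_sigma cube non_cube by (metis DiffE singletonI)
qed

end
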